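(* (Lax representation with spectral parameter $z$ for the pentagram map.) All indices $i$ are mod $n$. (1) Let $n$ be not divisible by $3$, $m=\lfloor n/3\rfloor$, and $$L_{i,t}(z)=\begin{pmatrix} -b_i & 1 & 0 \\ -a_i/z & 0 & 1/z \\ 1 & 0 & 0 \end{pmatrix}=\begin{pmatrix} 0 & 0 & 1 \\ 1 & 0 & b_i \\ 0 & z & a_i \end{pmatrix}^{-1},\qquad \lambda_i=\prod_{l=1}^m(1+a_{i+3l+1}b_{i+3l}).$$ If $n=3m+1$ let $$P_{i,t}=\begin{pmatrix} -a_i\lambda_{i-1} & 0 & \lambda_{i-1} \\ \lambda_{i-3} & -a_{i+1}\lambda_i & b_{i-1}\lambda_{i-3} \\ 0 & z\lambda_{i-2} & 0 \end{pmatrix},$$ and if $n=3m+2$ let $$P_{i,t}=\begin{pmatrix} -a_i\lambda_i\lambda_{i-1}(1+a_{i+1}b_i) & 0 & \lambda_i\lambda_{i-1}(1+a_{i+1}b_i) \\ \lambda_i\lambda_{i-2}(1+a_{i+1}b_i) & -a_{i+1}\lambda_i\lambda_{i+1}(1+a_{i+2}b_{i+1}) & b_{i-1}\lambda_i\lambda_{i-2}(1+a_{i+1}b_i) \\ 0 & z\lambda_{i+1}\lambda_{i-1}(1+a_{i+2}b_{i+1}) & 0 \end{pmatrix}.$$ Here all $a_i,b_i$ are taken at time $t$. Then $L_{i,t}$ is a Lax function for the pentagram map in the coordinates $a_i,b_i$: the discrete zero-curvature equation $$L_{i,t+1}(z)=P_{i+1,t}(z)L_{i,t}(z)P_{i,t}^{-1}(z)\quad\text{for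 all }i$$ is equivalent to the formulas of the pentagram map expressing $a_i,b_i$ at time $t+1$ through those at time $t$. (2) For any $n$, let $$\tilde L_{i,t}(z)=\begin{pmatrix} 1/x_{i+2} & -1/x_{i+2} & 0 \\ 1/z & 0 & 1/z \\ -y_{i+2} & 0 & 0 \end{pmatrix}=\begin{pmatrix} 0 & 0 & -1/y_{i+2} \\ -x_{i+2} & 0 & -1/y_{i+2} \\ 0 & z & 1/y_{i+2} \end{pmatrix}^{-1},$$ $$\tilde P_{i,t}(z)=\begin{pmatrix} 1-x_{i+2}y_{i+2} & 0 & 1-x_{i+2}y_{i+2} \\ {x_{i+1}}y_{i+1}(1-x_{i+2}y_{i+2}) & 1-x_{i+1}y_{i+1} & 1-x_{i+2}y_{i+2} \\ 0 & -zy_{i+2}(1-x_{i+3}y_{i+3}) & 0 \end{pmatrix},$$ all $x_i,y_i$ taken at time $t$. Then $\tilde L_{i,t}$ is a Lax function for the pentagram map in the coordinates $x_i,y_i$: the equation $\tilde L_{i,t+1}=\tilde P_{i+1,t}\tilde L_{i,t}\tilde P_{i,t}^{-1}$ for all $i$ is equivalent to the formulas of the pentagram map in the coordinates $x_i,y_i$.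
   Context: Formulas of the pentagram map (time $t\to t+1$), with all variables $n$-periodic in the index and defined where the denominators do not vanish: In coordinates $a_i,b_i$ ($n\not\equiv0$ mod $3$, $m=\lfloor n/3\rfloor$): $$a_i\mapsto a_{i+2}\prod_{l=1}^m\frac{1+a_{i+3l+2}b_{i+3l+1}}{1+a_{i-3l+2}b_{i-3l+1}},\qquad b_i\mapsto b_{i-1}\prod_{l=1}^m\frac{1+a_{i-3l}b_{i-3l-1}}{1+a_{i+3l}b_{i+3l-1}}.$$ In coordinates $x_i,y_i$ (any $n$): $$x_i\mapsto x_i\frac{1-x_{i-1}y_{i-1}}{1-x_{i+1}y_{i+1}},\qquad y_i\mapsto y_{i+1}\frac{1-x_{i+2}y_{i+2}}{1-x_iy_i}.$$ (Background: the coordinates are on the space of twisted $n$-gons in $\mathbb{CP}^2$ modulo projective equivalence; $a_i,b_i$ come from lifts with $V_{j+3}=a_jV_{j+2}+b_jV_{j+1}+V_j$, and $x_i=\frac{a_{i-2}}{b_{i-2}b_{i-1}}$, $y_i=-\frac{b_{i-1}}{a_{i-2}a_{i-1}}$.) $L_{i,t+1}$ (resp. $\tilde L_{i,t+1}$) denotes the matrix $L_{i,t}$ (resp. $\tilde L_{i,t}$) with the variables taken at time $t+1$. Variables are generic, so that all matrices inverted are invertible. *)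

theory Defs
  imports "HOL-Analysis.Analysis"
begin

text \<open>Sequences indexed modulo \<open>n\<close> are represented by \<open>n\<close>-periodic functions on the integers.\<close>

definition periodic :: "nat \<Rightarrow> (int \<Rightarrow> complex) \<Rightarrow> bool" where
  "periodic n f \<longleftrightarrow> (\<forall>i. f (i + int n) = f i)"

text \<open>Unprimed variables are taken at time \<open>t\<close>, primed ones at time \<open>t + 1\<close>.\<close>

definition pentagram_ab ::
  "nat \<Rightarrow> (int \<Rightarrow> complex) \<Rightarrow> (int \<Rightarrow> complex) \<Rightarrow> (int \<Rightarrow> complex) \<Rightarrow> (int \<Rightarrow> complex) \<Rightarrow> bool" where
  "pentagram_ab n a b a' b' \<longleftrightarrow>
    (\<forall>i. a' i = a (i + 2) *
            (\<Prod>l = 1..n div 3.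
               (1 + a (i + 3 * int l + 2) * b (i + 3 * int l + 1)) /
               (1 + a (i - 3 * int l + 2) * b (i - 3 * int l + 1))) \<and>
         b' i = b (i - 1) *
            (\<Prod>l = 1..n div 3.
               (1 + a (i - 3 * int l) * b (i - 3 * int l - 1)) /
               (1 + a (i + 3 * int l) * b (i + 3 * int l - 1))))"

definition pentagram_xy ::
  "(int \<Rightarrow> complex) \<Rightarrow> (int \<Rightarrow> complex) \<Rightarrow> (int \<Rightarrow> complex) \<Rightarrow> (int \<Rightarrow> complex) \<Rightarrow> bool" where
  "pentagram_xy x y x' y' \<longleftrightarrow>
    (\<forall>i. x' i = x i * ((1 - x (i - 1) * y (i - 1)) / (1 - x (i + 1) * y (i + 1))) \<and>
         y' i = y (i + 1) * ((1 - x (i + 2) * y (i + 2)) / (1 - x i * y i)))"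

text \<open>The matrix functions take the spectral parameter \<open>z\<close> and the index \<open>i\<close>. They are Laurent
  polynomials in \<open>z\<close>, so identities in \<open>z\<close> are required at every \<open>z \<noteq> 0\<close>.\<close>

definition zero_curvature ::
  "(complex \<Rightarrow> int \<Rightarrow> complex^3^3) \<Rightarrow> (complex \<Rightarrow> int \<Rightarrow> complex^3^3) \<Rightarrow>
   (complex \<Rightarrow> int \<Rightarrow> complex^3^3) \<Rightarrow> bool" where
  "zero_curvature L P L' \<longleftrightarrow>
    (\<forall>z. z \<noteq> 0 \<longrightarrow> (\<forall>i. L' z i = P z (i + 1) ** L z i ** matrix_inv (P z i)))"

definition lax_ab :: "(int \<Rightarrow> complex) \<Rightarrow> (int \<Rightarrow> complex) \<Rightarrow> complex \<Rightarrow> int \<Rightarrow> complex^3^3" where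
  "lax_ab a b z i = vector [
     vector [- b i, 1, 0],
     vector [- a i / z, 0, 1 / z],
     vector [1, 0, 0]]"

definition lax_ab_inverse ::
  "(int \<Rightarrow> complex) \<Rightarrow> (int \<Rightarrow> complex) \<Rightarrow> complex \<Rightarrow> int \<Rightarrow> complex^3^3" where
  "lax_ab_inverse a b z i = vector [
     vector [0, 0, 1],
     vector [1, 0, b i],
     vector [0, z, a i]]"

definition lam :: "nat \<Rightarrow> (int \<Rightarrow> complex) \<Rightarrow> (int \<Rightarrow> complex) \<Rightarrow> int \<Rightarrow> complex" where
  "lam n a b i = (\<Prod>l = 1..n div 3. 1 + a (i + 3 * int l + 1) * b (i + 3 * int l))"

text \<open>The first branch is \<open>n = 3 m + 1\<close>; the second is meant for \<open>n = 3 m + 2\<close> and carries no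
  meaning if \<open>3\<close> divides \<open>n\<close>.\<close>

definition P_ab ::
  "nat \<Rightarrow> (int \<Rightarrow> complex) \<Rightarrow> (int \<Rightarrow> complex) \<Rightarrow> complex \<Rightarrow> int \<Rightarrow> complex^3^3" where
  "P_ab n a b z i =
    (let lm = lam n a b in
     if n mod 3 = 1 then
       vector [
         vector [- a i * lm (i - 1), 0, lm (i - 1)],
         vector [lm (i - 3), - a (i + 1) * lm i, b (i - 1) * lm (i - 3)],
         vector [0, z * lm (i - 2), 0]]
     else
       vector [
         vector [- a i * lm i * lm (i - 1) * (1 + a (i + 1) * b i),
                 0,
                 lm i * lm (i - 1) * (1 + a (i + 1) * b i)],
         vector [lm i * lm (i - 2) * (1 + a (i + 1) * b i),
                 - a (i + 1) * lm i * lm (i + 1) * (1 + a (i + 2) * b (i + 1)),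
                 b (i - 1) * lm i * lm (i - 2) * (1 + a (i + 1) * b i)],
         vector [0,
                 z * lm (i + 1) * lm (i - 1) * (1 + a (i + 2) * b (i + 1)),
                 0]])"

definition lax_xy :: "(int \<Rightarrow> complex) \<Rightarrow> (int \<Rightarrow> complex) \<Rightarrow> complex \<Rightarrow> int \<Rightarrow> complex^3^3" where
  "lax_xy x y z i = vector [
     vector [1 / x (i + 2), - 1 / x (i + 2), 0],
     vector [1 / z, 0, 1 / z],
     vector [- y (i + 2), 0, 0]]"

definition lax_xy_inverse ::
  "(int \<Rightarrow> complex) \<Rightarrow> (int \<Rightarrow> complex) \<Rightarrow> complex \<Rightarrow> int \<Rightarrow> complex^3^3" where
  "lax_xy_inverse x y z i = vector [
     vector [0, 0, - 1 / y (i + 2)],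
     vector [- x (i + 2), 0, - 1 / y (i + 2)],
     vector [0, z, 1 / y (i + 2)]]"

definition P_xy :: "(int \<Rightarrow> complex) \<Rightarrow> (int \<Rightarrow> complex) \<Rightarrow> complex \<Rightarrow> int \<Rightarrow> complex^3^3" where
  "P_xy x y z i = vector [
     vector [1 - x (i + 2) * y (i + 2), 0, 1 - x (i + 2) * y (i + 2)],
     vector [x (i + 1) * y (i + 1) * (1 - x (i + 2) * y (i + 2)),
             1 - x (i + 1) * y (i + 1),
             1 - x (i + 2) * y (i + 2)],
     vector [0, - z * y (i + 2) * (1 - x (i + 3) * y (i + 3)), 0]]"

text \<open>Genericity: on periodic sequences these conditions say exactly that every \<open>P\<close> is invertible
  for \<open>z \<noteq> 0\<close> and, in the second case, that the entries \<open>1 / x i\<close> and \<open>1 / y i\<close> are defined;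
  they also make all denominators of the pentagram map nonzero.\<close>

definition generic_ab :: "(int \<Rightarrow> complex) \<Rightarrow> (int \<Rightarrow> complex) \<Rightarrow> bool" where
  "generic_ab a b \<longleftrightarrow> (\<forall>i. 1 + a (i + 1) * b i \<noteq> 0)"

definition generic_xy :: "(int \<Rightarrow> complex) \<Rightarrow> (int \<Rightarrow> complex) \<Rightarrow> bool" where
  "generic_xy x y \<longleftrightarrow> (\<forall>i. x i \<noteq> 0 \<and> y i \<noteq> 0 \<and> 1 - x i * y i \<noteq> 0)"

end

theory Submission
  imports Defs
begin

text \<open>Write \<open>c\<^sub>i = 1 + a\<^sub>i\<^sub>+\<^sub>1 b\<^sub>i\<close>. Multiplied by \<open>P\<^sub>i\<close> on the right, the zero-curvature equation becomes
  \<open>L' P\<^sub>i = P\<^sub>i\<^sub>+\<^sub>1 L\<close>, which is compared entry by entry. For both residues of \<open>n\<close> modulo 3 the matrix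
  \<open>P\<^sub>i\<close> depends on a single scalar sequence \<open>p\<close>, and the equation reduces to
  \<open>a'\<^sub>i p\<^sub>i = a\<^sub>i\<^sub>+\<^sub>2 p\<^sub>i\<^sub>+\<^sub>2\<close> and \<open>b'\<^sub>i p\<^sub>i = b\<^sub>i\<^sub>-\<^sub>1 p\<^sub>i\<^sub>-\<^sub>2\<close> as soon as
  \<open>p\<^sub>i\<^sub>-\<^sub>2 c\<^sub>i\<^sub>-\<^sub>1 = p\<^sub>i\<^sub>+\<^sub>1 c\<^sub>i\<close>. The products in the pentagram map are the quotients of the \<open>p\<^sub>i\<close>
  because periodicity turns the product over \<open>c\<^sub>i\<^sub>-\<^sub>3\<^sub>l\<close> into a shift of the product
  \<open>\<lambda>\<^sub>i\<close> over \<open>c\<^sub>i\<^sub>+\<^sub>3\<^sub>l\<close>.\<close>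

section \<open>Inverses of 3 by 3 matrices\<close>

lemma matrix_inv_inverse:
  fixes A :: "complex^3^3"
  assumes "invertible A"
  shows "A ** matrix_inv A = mat 1 \<and> matrix_inv A ** A = mat 1"
  using assms unfolding invertible_def matrix_inv_def by (rule someI_ex)

lemma eq_mult_matrix_inv_iff:
  fixes A B M :: "complex^3^3"
  assumes "invertible A"
  shows "M = B ** matrix_inv A \<longleftrightarrow> M ** A = B"
  by (metis assms matrix_inv_inverse matrix_mul_assoc matrix_mul_rid)

lemma invertible_eq_matrix_inv:
  fixes A B :: "complex^3^3"
  assumes AB: "A ** B = mat 1"
  shows "invertible B \<and> A = matrix_inv B"
proof -
  have inv: "invertible B"
    using AB invertible_left_inverse by blast
  with AB have "A = mat 1 ** matrix_inv B"
    using eq_mult_matrix_inv_iff by blast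
  with inv show ?thesis by simp
qed

lemmas mat3_simps = vec_eq_iff forall_3 matrix_matrix_mult_def sum_3 vector_3 mat_def

lemma lax_ab_inverse_inv:
  assumes "z \<noteq> 0"
  shows "invertible (lax_ab_inverse a b z i) \<and> lax_ab a b z i = matrix_inv (lax_ab_inverse a b z i)"
  by (rule invertible_eq_matrix_inv)
    (use assms in \<open>simp add: mat3_simps lax_ab_def lax_ab_inverse_def field_simps\<close>)

lemma lax_xy_inverse_inv:
  assumes "z \<noteq> 0" "generic_xy x y"
  shows "invertible (lax_xy_inverse x y z i) \<and> lax_xy x y z i = matrix_inv (lax_xy_inverse x y z i)"
  by (rule invertible_eq_matrix_inv)
    (use assms in \<open>simp add: mat3_simps lax_xy_def lax_xy_inverse_def generic_xy_def field_simps\<close>)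

section \<open>The coordinates \<open>x\<close>, \<open>y\<close>\<close>

lemma invertible_P_xy:
  assumes "z \<noteq> 0" "generic_xy x y"
  shows "invertible (P_xy x y z i)"
proof -
  define s where "s j = 1 - x j * y j" for j
  have nz: "s j \<noteq> 0" "y j \<noteq> 0" for j
    using assms by (auto simp: generic_xy_def s_def)
  have "det (P_xy x y z i) = z * y (i + 2) * s (i + 3) * s (i + 2) ^ 2 * s (i + 1)"
    by (simp add: det_3 P_xy_def s_def vector_3) algebra
  then show ?thesis
    using nz assms by (simp add: invertible_det_nz)
qed

text \<open>\<open>lax_xy\<close> at index \<open>i\<close> holds its variables at
  \<open>i + 2\<close>, hence the shifted indices. The value \<open>x' (i + 2)\<close> may be 0,
  where division returns 0; this case is treated separately.\<close>

lemma zero_curvature_xy_pointwise: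
  assumes z: "z \<noteq> 0" and gen: "generic_xy x y"
  shows "lax_xy x' y' z i = P_xy x y z (i + 1) ** lax_xy x y z i ** matrix_inv (P_xy x y z i) \<longleftrightarrow>
    x' (i + 2) = x (i + 2) * ((1 - x (i + 1) * y (i + 1)) / (1 - x (i + 3) * y (i + 3))) \<and>
    y' (i + 2) = y (i + 3) * ((1 - x (i + 4) * y (i + 4)) / (1 - x (i + 2) * y (i + 2)))"
proof -
  define s where "s j = 1 - x j * y j" for j
  have nz: "s j \<noteq> 0" "x j \<noteq> 0" "y j \<noteq> 0" for j
    using gen by (auto simp: generic_xy_def s_def)
  have L: "lax_xy x' y' z i ** P_xy x y z i = vector [
      vector [s (i + 1) / x' (i + 2) * s (i + 2), - (s (i + 1) / x' (i + 2)), 0],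
      vector [s (i + 2) / z, - y (i + 2) * s (i + 3), s (i + 2) / z],
      vector [- y' (i + 2) * s (i + 2), 0, - y' (i + 2) * s (i + 2)]]"
    using z by (cases "x' (i + 2) = 0")
      (simp_all add: mat3_simps lax_xy_def P_xy_def s_def field_simps)
  have R: "P_xy x y z (i + 1) ** lax_xy x y z i = vector [
      vector [s (i + 3) / x (i + 2) * s (i + 2), - (s (i + 3) / x (i + 2)), 0],
      vector [s (i + 2) / z, - y (i + 2) * s (i + 3), s (i + 2) / z],
      vector [- y (i + 3) * s (i + 4), 0, - y (i + 3) * s (i + 4)]]"
    using z nz(2)[of "i + 2"] by (simp add: mat3_simps lax_xy_def P_xy_def s_def field_simps)
  have "lax_xy x' y' z i ** P_xy x y z i = P_xy x y z (i + 1) ** lax_xy x y z i \<longleftrightarrow>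
      s (i + 1) / x' (i + 2) = s (i + 3) / x (i + 2) \<and> y' (i + 2) * s (i + 2) = y (i + 3) * s (i + 4)"
    \<comment> \<open>The first row gives one condition twice, and so does the third. Without
      \<open>times_divide_eq_left\<close> the quotients stay intact and the common factor
      \<open>s (i + 2)\<close> cancels.\<close>
    unfolding L R using nz(1)[of "i + 2"]
    by (simp add: mat3_simps del: times_divide_eq_left)
  also have "s (i + 1) / x' (i + 2) = s (i + 3) / x (i + 2) \<longleftrightarrow>
      x' (i + 2) = x (i + 2) * (s (i + 1) / s (i + 3))"
    \<comment> \<open>If \<open>x' (i + 2) = 0\<close>, both equations fail: in each, one side is 0
      and the other is not.\<close>
    using nz[of "i + 1"] nz[of "i + 2"] nz[of "i + 3"]
    by (cases "x' (i + 2) = 0") (auto simp: field_simps)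
  also have "y' (i + 2) * s (i + 2) = y (i + 3) * s (i + 4) \<longleftrightarrow>
      y' (i + 2) = y (i + 3) * (s (i + 4) / s (i + 2))"
    using nz[of "i + 2"] by (auto simp: field_simps)
  finally show ?thesis
    using eq_mult_matrix_inv_iff[OF invertible_P_xy[OF z gen]] by (simp add: s_def)
qed

lemma zero_curvature_xy:
  assumes "generic_xy x y"
  shows "zero_curvature (lax_xy x y) (P_xy x y) (lax_xy x' y') \<longleftrightarrow> pentagram_xy x y x' y'"
proof -
  define F where "F i \<longleftrightarrow> x' i = x i * ((1 - x (i - 1) * y (i - 1)) / (1 - x (i + 1) * y (i + 1))) \<and>
         y' i = y (i + 1) * ((1 - x (i + 2) * y (i + 2)) / (1 - x i * y i))" for i
  have "zero_curvature (lax_xy x y) (P_xy x y) (lax_xy x' y') \<longleftrightarrow> (\<forall>z::complex. z \<noteq> 0 \<longrightarrow> (\<forall>i. F (i + 2)))"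
    unfolding zero_curvature_def
    by (intro arg_cong[where f = All] ext imp_cong refl)
      (simp add: zero_curvature_xy_pointwise assms F_def add.commute)
  \<comment> \<open>The formulas are free of \<open>z\<close>, so the single value
    \<open>z = 1\<close> yields them.\<close>
  also have "\<dots> \<longleftrightarrow> (\<forall>i. F (i + 2))"
    using zero_neq_one by metis
  also have "\<dots> \<longleftrightarrow> (\<forall>i. F i)"
    by (metis diff_add_cancel)
  finally show ?thesis
    by (simp add: pentagram_xy_def F_def)
qed

section \<open>The coordinates \<open>a\<close>, \<open>b\<close> with a general scaling
  sequence\<close>

text \<open>Common shape of the two branches of \<open>P_ab\<close>, so that both residues share one
  entrywise comparison.\<close>

definition P_scaled ::
  "(int \<Rightarrow> complex) \<Rightarrow> (int \<Rightarrow> complex) \<Rightarrow> (int \<Rightarrow> complex) \<Rightarrow> complex \<Rightarrow> int \<Rightarrow> complex^3^3" where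
  "P_scaled a b p z i = vector [
     vector [- a i * p i, 0, p i],
     vector [p (i - 2), - a (i + 1) * p (i + 1), b (i - 1) * p (i - 2)],
     vector [0, z * p (i - 1), 0]]"

lemma invertible_P_scaled:
  assumes "z \<noteq> 0" "generic_ab a b" "\<And>i. p i \<noteq> 0"
  shows "invertible (P_scaled a b p z i)"
proof -
  have "det (P_scaled a b p z i) = z * p (i - 1) * p i * p (i - 2) * (1 + a i * b (i - 1))"
    by (simp add: det_3 P_scaled_def vector_3) algebra
  moreover have "1 + a i * b (i - 1) \<noteq> 0"
    using assms(2) unfolding generic_ab_def by (metis diff_add_cancel)
  ultimately show ?thesis
    using assms by (simp add: invertible_det_nz)
qed

lemma zero_curvature_ab_pointwise:
  assumes z: "z \<noteq> 0" and gen: "generic_ab a b" and nz: "\<And>i. p i \<noteq> 0"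
    and rec: "p (i - 2) * (1 + a i * b (i - 1)) = p (i + 1) * (1 + a (i + 1) * b i)"
  shows "lax_ab a' b' z i = P_scaled a b p z (i + 1) ** lax_ab a b z i ** matrix_inv (P_scaled a b p z i) \<longleftrightarrow>
    a' i * p i = a (i + 2) * p (i + 2) \<and> b' i * p i = b (i - 1) * p (i - 2)"
proof -
  have L: "lax_ab a' b' z i ** P_scaled a b p z i = vector [
      vector [a i * (b' i * p i) + p (i - 2), - a (i + 1) * p (i + 1), b (i - 1) * p (i - 2) - b' i * p i],
      vector [a i * (a' i * p i) / z, p (i - 1), - (a' i * p i / z)],
      vector [- a i * p i, 0, p i]]"
    using z by (simp add: mat3_simps lax_ab_def P_scaled_def field_simps)
  have "P_scaled a b p z (i + 1) ** lax_ab a b z i = vector [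
      vector [p (i + 1) * (1 + a (i + 1) * b i), - a (i + 1) * p (i + 1), 0],
      vector [a i * (a (i + 2) * p (i + 2)) / z, p (i - 1), - (a (i + 2) * p (i + 2) / z)],
      vector [- a i * p i, 0, p i]]"
    using z by (simp add: mat3_simps lax_ab_def P_scaled_def field_simps)
  \<comment> \<open>After this rewriting, equality of the top left entries follows from equality of
    the top right ones.\<close>
  note R = this[folded rec]
  have "lax_ab a' b' z i ** P_scaled a b p z i = P_scaled a b p z (i + 1) ** lax_ab a b z i \<longleftrightarrow>
    a' i * p i = a (i + 2) * p (i + 2) \<and> b' i * p i = b (i - 1) * p (i - 2)"
    unfolding L R using z by (auto simp: mat3_simps algebra_simps)
  then show ?thesis
    using eq_mult_matrix_inv_iff[OF invertible_P_scaled[OF z gen nz]] by simp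
qed

lemma zero_curvature_ab:
  assumes gen: "generic_ab a b" and nz: "\<And>i. p i \<noteq> 0"
    and rec: "\<And>i. p (i - 2) * (1 + a i * b (i - 1)) = p (i + 1) * (1 + a (i + 1) * b i)"
  shows "zero_curvature (lax_ab a b) (P_scaled a b p) (lax_ab a' b') \<longleftrightarrow>
    (\<forall>i. a' i * p i = a (i + 2) * p (i + 2) \<and> b' i * p i = b (i - 1) * p (i - 2))"
proof -
  have "zero_curvature (lax_ab a b) (P_scaled a b p) (lax_ab a' b') \<longleftrightarrow>
    (\<forall>z::complex. z \<noteq> 0 \<longrightarrow> (\<forall>i. a' i * p i = a (i + 2) * p (i + 2) \<and> b' i * p i = b (i - 1) * p (i - 2)))"
    unfolding zero_curvature_def
    using zero_curvature_ab_pointwise[OF _ gen nz rec] by meson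
  then show ?thesis
    using zero_neq_one by metis
qed

section \<open>Products along steps of 3 and periodicity\<close>

text \<open>Both sides are the product of \<open>c\<^sub>j\<close> over
  \<open>j = i, i + 3, ..., i + 3 * (n div 3)\<close>, with the last or the first factor split
  off.\<close>

lemma lam_shift_3:
  "lam n a b (i - 3) * (1 + a (i + 3 * int (n div 3) + 1) * b (i + 3 * int (n div 3))) =
    lam n a b i * (1 + a (i + 1) * b i)"
proof -
  define m where "m = n div 3"
  define f where "f l = 1 + a (i + 3 * int l + 1) * b (i + 3 * int l)" for l
  have "lam n a b (i - 3) = prod f {0..<m}"
    unfolding lam_def m_def[symmetric] f_def
    by (rule prod.reindex_bij_witness[where i = Suc and j = "\<lambda>l. l - 1"])
      (auto simp: of_nat_diff algebra_simps)
  moreover have "lam n a b i = prod f {1..m}"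
    by (simp add: lam_def m_def f_def)
  moreover have "prod f {0..<m} * f m = prod f {0..m}"
    by (simp add: atLeast0LessThan atLeast0AtMost lessThan_Suc_atMost[symmetric])
  moreover have "prod f {0..m} = f 0 * prod f {1..m}"
    by (simp add: prod.atLeast_Suc_atMost)
  ultimately show ?thesis
    by (simp add: f_def m_def mult.commute)
qed

text \<open>Adding the period \<open>n = 3 m + r\<close> turns the index \<open>i - 3 l\<close> into
  \<open>(i + r - 3) + 3 (m + 1 - l)\<close>, so the factors are those of a \<open>lam\<close>, in
  reverse order.\<close>

lemma prod_backward_eq_lam:
  assumes "periodic n a" "periodic n b"
  shows "(\<Prod>l = 1..n div 3. 1 + a (i - 3 * int l + 1) * b (i - 3 * int l)) =
    lam n a b (i + int (n mod 3) - 3)"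
proof -
  define m where "m = n div 3"
  have n: "int n = 3 * int m + int (n mod 3)"
    unfolding m_def by (metis mult_div_mod_eq of_nat_add of_nat_mult of_nat_numeral)
  have per: "a (j - int n) = a j" "b (j - int n) = b j" for j
    using assms unfolding periodic_def by (metis diff_add_cancel)+
  show ?thesis
    unfolding lam_def m_def[symmetric]
  proof (rule prod.reindex_bij_witness[where i = "\<lambda>l. m + 1 - l" and j = "\<lambda>l. m + 1 - l"])
    fix l assume l: "l \<in> {1..m}"
    let ?j = "i + int (n mod 3) - 3 + 3 * int (m + 1 - l)"
    have "i - 3 * int l = ?j - int n" "i - 3 * int l + 1 = ?j + 1 - int n"
      using l n by (auto simp: of_nat_diff)
    then show "1 + a (?j + 1) * b ?j = 1 + a (i - 3 * int l + 1) * b (i - 3 * int l)"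
      by (simp only: per)
  qed auto
qed

text \<open>\<open>ratio\<close> says that the product for \<open>a' i\<close> is
  \<open>p (i + 2) / p i\<close>. The product for \<open>b' i\<close> is the reciprocal of the one
  for \<open>a'\<close> at \<open>i - 2\<close>.\<close>

lemma pentagram_ab_iff:
  assumes per: "periodic n a" "periodic n b" and gen: "generic_ab a b" and nz: "\<And>i. p i \<noteq> 0"
    and ratio: "\<And>i. p (i + 2) * lam n a b (i + int (n mod 3) - 2) = p i * lam n a b (i + 1)"
  shows "pentagram_ab n a b a' b' \<longleftrightarrow>
    (\<forall>i. a' i * p i = a (i + 2) * p (i + 2) \<and> b' i * p i = b (i - 1) * p (i - 2))"
proof -
  have lam_nz: "lam n a b i \<noteq> 0" for i
    using gen by (simp add: lam_def generic_ab_def)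
  have A: "(\<Prod>l = 1..n div 3. (1 + a (i + 3 * int l + 2) * b (i + 3 * int l + 1)) /
      (1 + a (i - 3 * int l + 2) * b (i - 3 * int l + 1))) = p (i + 2) / p i" (is "?l = _") for i
  proof -
    have l: "?l = lam n a b (i + 1) / lam n a b (i + 1 + int (n mod 3) - 3)"
      unfolding prod_backward_eq_lam[OF per, symmetric]
      by (simp add: prod_dividef lam_def algebra_simps)
    show ?thesis
      unfolding l using ratio[of i] nz[of i] lam_nz by (simp add: field_simps)
  qed
  have B: "(\<Prod>l = 1..n div 3. (1 + a (i - 3 * int l) * b (i - 3 * int l - 1)) /
      (1 + a (i + 3 * int l) * b (i + 3 * int l - 1))) = p (i - 2) / p i" (is "?l = _") for i
  proof -
    have l: "?l = lam n a b (i - 1 + int (n mod 3) - 3) / lam n a b (i - 1)"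
      unfolding prod_backward_eq_lam[OF per, symmetric]
      by (simp add: prod_dividef lam_def algebra_simps)
    show ?thesis
      unfolding l using ratio[of "i - 2"] nz[of i] lam_nz by (simp add: field_simps)
  qed
  show ?thesis
    unfolding pentagram_ab_def A B using nz by (simp add: field_simps)
qed

text \<open>The sequence \<open>p\<close> is read off the top right entry of
  \<open>P_ab\<close>.\<close>

lemma P_ab_scaled:
  assumes n: "\<not> 3 dvd n" and per: "periodic n a" "periodic n b" and gen: "generic_ab a b"
  obtains p where "P_ab n a b = P_scaled a b p" "\<And>i. p i \<noteq> 0"
    "\<And>i. p (i - 2) * (1 + a i * b (i - 1)) = p (i + 1) * (1 + a (i + 1) * b i)"
    "\<And>i. p (i + 2) * lam n a b (i + int (n mod 3) - 2) = p i * lam n a b (i + 1)"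
proof -
  define l where "l = lam n a b"
  define c where "c i = 1 + a (i + 1) * b i" for i
  have c': "1 + a i * b (i - 1) = c (i - 1)" for i
    by (simp add: c_def)
  have nz: "l i \<noteq> 0" "c i \<noteq> 0" for i
    using gen by (simp_all add: l_def lam_def c_def generic_ab_def)
  \<comment> \<open>This is \<open>lam_shift_3\<close> with the index
    \<open>i + 3 * (n div 3)\<close> lowered by the period \<open>n\<close>.\<close>
  have shift: "l (i - 3) * c (i - int (n mod 3)) = l i * c i" for i
  proof -
    have j: "i - int (n mod 3) + int n = i + 3 * int (n div 3)"
      using mult_div_mod_eq[of 3 n] by linarith
    have "c (i - int (n mod 3) + int n) = c (i - int (n mod 3))"
      using per unfolding periodic_def c_def
      by (metis add.assoc add.commute)
    then show ?thesis
      using lam_shift_3[of n a b i] unfolding j by (simp add: l_def c_def)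
  qed
  have "n mod 3 = 1 \<or> n mod 3 = 2"
    using n by presburger
  then show thesis
  proof
    assume 1: "n mod 3 = 1"
    show thesis
    proof (rule that[of "\<lambda>i. l (i - 1)"])
      show "P_ab n a b = P_scaled a b (\<lambda>i. l (i - 1))"
        using 1 by (intro ext) (simp add: P_ab_def P_scaled_def Let_def l_def)
    qed (use nz shift 1 in \<open>simp_all add: c' c_def[symmetric] l_def[symmetric] add.commute\<close>)
  next
    assume 2: "n mod 3 = 2"
    define p where "p i = l i * l (i - 1) * c i" for i
    \<comment> \<open>Here \<open>shift\<close> replaces \<open>l (i - 3) * c (i - 2)\<close> by
      \<open>l i * c i\<close>, which gives the entries in the form used in
      \<open>P_ab\<close>.\<close>
    have q: "p (i - 2) = l i * l (i - 2) * c i" for i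
      using shift[of i] 2 by (simp add: p_def)
    show thesis
    proof (rule that[of p])
      show "P_ab n a b = P_scaled a b p"
      proof (intro ext)
        fix z i
        have "p (i - 1) = l (i + 1) * l (i - 1) * c (i + 1)"
          using q[of "i + 1"] by simp
        then show "P_ab n a b z i = P_scaled a b p z i"
          using 2 unfolding P_ab_def P_scaled_def q
          by (simp add: Let_def l_def[symmetric] p_def c_def algebra_simps)
      qed
      show "p i \<noteq> 0" for i
        using nz by (simp add: p_def)
      show "p (i - 2) * (1 + a i * b (i - 1)) = p (i + 1) * (1 + a (i + 1) * b i)" for i
        using shift[of "i + 1"] 2 unfolding q c' c_def[symmetric] by (simp add: p_def)
      show "p (i + 2) * lam n a b (i + int (n mod 3) - 2) = p i * lam n a b (i + 1)" for i
      proof -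
        \<comment> \<open>Written this way, \<open>p i\<close> and \<open>p (i + 2)\<close> share
          the factor \<open>l (i + 2) * c (i + 2)\<close>.\<close>
        have "p i = l (i + 2) * l i * c (i + 2)" "p (i + 2) = l (i + 2) * l (i + 1) * c (i + 2)"
          using q[of "i + 2"] by (simp_all add: p_def add.commute)
        then show ?thesis
          using 2 by (simp add: l_def[symmetric] add.commute)
      qed
    qed
  qed
qed

theorem theorem2p2:
  fixes n :: nat
  assumes "0 < n"
  shows
    "(\<not> 3 dvd n \<longrightarrow>
       (\<forall>a b a' b'.
          periodic n a \<and> periodic n b \<and> periodic n a' \<and> periodic n b' \<and> generic_ab a b \<longrightarrow>
          (\<forall>z i. z \<noteq> 0 \<longrightarrow>
             invertible (lax_ab_inverse a b z i) \<and>
             lax_ab a b z i = matrix_inv (lax_ab_inverse a b z i) \<and>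
             invertible (P_ab n a b z i)) \<and>
          (zero_curvature (lax_ab a b) (P_ab n a b) (lax_ab a' b') \<longleftrightarrow>
             pentagram_ab n a b a' b'))) \<and>
     (\<forall>x y x' y'.
          periodic n x \<and> periodic n y \<and> periodic n x' \<and> periodic n y' \<and> generic_xy x y \<longrightarrow>
          (\<forall>z i. z \<noteq> 0 \<longrightarrow>
             invertible (lax_xy_inverse x y z i) \<and>
             lax_xy x y z i = matrix_inv (lax_xy_inverse x y z i) \<and>
             invertible (P_xy x y z i)) \<and>
          (zero_curvature (lax_xy x y) (P_xy x y) (lax_xy x' y') \<longleftrightarrow>
             pentagram_xy x y x' y'))"
proof (intro conjI impI allI; (elim conjE)?)
  fix a b a' b' :: "int \<Rightarrow> complex" and z :: complex and i
  assume n: "\<not> 3 dvd n" and per: "periodic n a" "periodic n b" and gen: "generic_ab a b"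
  obtain p where P: "P_ab n a b = P_scaled a b p" and nz: "\<And>i. p i \<noteq> 0"
    and rec: "\<And>i. p (i - 2) * (1 + a i * b (i - 1)) = p (i + 1) * (1 + a (i + 1) * b i)"
    and ratio: "\<And>i. p (i + 2) * lam n a b (i + int (n mod 3) - 2) = p i * lam n a b (i + 1)"
    using P_ab_scaled[OF n per gen] by blast
  show "zero_curvature (lax_ab a b) (P_ab n a b) (lax_ab a' b') \<longleftrightarrow> pentagram_ab n a b a' b'"
    unfolding P zero_curvature_ab[OF gen nz rec] pentagram_ab_iff[OF per gen nz ratio] ..
  \<comment> \<open>Assumed only now, since the equivalence just shown is a goal without
    \<open>z\<close>.\<close>
  assume "z \<noteq> 0"
  then show "invertible (P_ab n a b z i)"
    unfolding P using gen nz by (rule invertible_P_scaled)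
qed (simp_all add: lax_ab_inverse_inv lax_xy_inverse_inv invertible_P_xy zero_curvature_xy)

end
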